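(* Let $f$ and $\mathcal S$ satisfy the standing assumptions, and let $\{x_k\}$ be the sequence produced by algorithm PGMM with inputs $x_0\in\mathcal S$, $\gamma,\delta\in(0,1)$, $0<\eta_{\min}\le\eta\le\eta_{\max}$, $\bar c_1,\bar c_2>0$, $0<\hat\nu_1\le\hat\nu_2$. Suppose $\eta_{\max}<\frac{2}{\hat\nu_1}$. Then, for any $\eta\in[\eta_{\min},\eta_{\max}]$ and any $\varepsilon>0$, denoting by $k_\varepsilon$ the first iteration index $k$ such that $\phi_\eta(x_k)\le\varepsilon$ and by $ni_\varepsilon$ the total number of iterations $k$ such that $\phi_\eta(x_k)>\varepsilon$, we have $$k_\varepsilon=\mathcal O(\varepsilon^{-2}),\qquad ni_\varepsilon=\mathcal O(\varepsilon^{-2}).$$ The bound $\mathcal O(\varepsilon^{-2})$ also holds for the number of function evaluations, the number of gradient evaluations and the number of projections carried out by the algorithm in the first $k_\varepsilon$ iterations. (Here $\mathcal O(\varepsilon^{-2})$ means bounded by $C\varepsilon^{-2}$ with $C$ independent of $\varepsilon$.) Moreover, if $\mathcal S$ is compact, either the algorithm stops in a finite number $\bar k$ of iterations returning a stationary point $x_{\bar k}$ of the problem $\min_{x\in\mathcal S}f(x)$, or the sequence $\{x_k\}$ has accumulation points, each one being stationary for the problem $\min_{x\in\mathcal S}f(x)$.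
   Context: Standing assumptions: $\mathcal S\subset\mathbb R^n$ is a (nonempty) closed convex set; $f:\mathbb R^n\to\mathbb R$ is smooth, possibly nonconvex; there is $f^*\in\mathbb R$ with $f(x)\ge f^*$ for all $x\in\mathcal S$; and there are $L>0$ and an open convex set $\mathcal D\supseteq\mathcal S$ such that $\|\nabla f(x)-\nabla f(y)\|\le L\|x-y\|$ for all $x,y\in\mathcal D$. Norms are Euclidean. Notation: $\mathcal P_{\mathcal S}[x]=\arg\min_{y\in\mathcal S}\|x-y\|$ is the Euclidean projection; for $\eta>0$ and $x\in\mathcal S$, $\phi_\eta(x)=\|\mathcal P_{\mathcal S}[x-\eta\nabla f(x)]-x\|$. A point $\bar x\in\mathcal S$ is stationary for $\min_{x\in\mathcal S}f(x)$ if $\nabla f(\bar x)^T(x-\bar x)\ge0$ for all $x\in\mathcal S$. At an iterate $x_k$ with vectors $\hat d_k,\hat s_k$ and for a symmetric matrix $H\in\mathbb R^{2\times2}$, $$\varphi_k(\alpha,\beta;H)=f(x_k)+\alpha\,\nabla f(x_k)^T\hat d_k+\beta\,\nabla f(x_k)^T\hat s_k+\tfrac12\begin{bmatrix}\alpha\\ \beta\end{bmatrix}^TH\begin{bmatrix}\alpha\\ \beta\end{bmatrix}.$$ Algorithm PGMM (projected gradient method with momentum). Inputs: $x_0\in\mathcal S$, $\gamma,\delta\in(0,1)$, $0<\eta_{\min}\le\eta\le\eta_{\max}$, $\bar c_1,\bar c_2>0$, $0<\hat\nu_1\le\hat\nu_2$. Set $x_{-1}=x_0$. For $k=0,1,\dots$: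 1. Set $s_k=x_k-x_{k-1}$, $y_k=\nabla f(x_k)-\nabla f(x_{k-1})$. If $s_k^Ty_k>0$ set $\eta_k=\min\{\eta_{\max},\max\{\eta_{\min},\frac{s_k^Ts_k}{s_k^Ty_k}\}\}$; otherwise set $\eta_k=\eta_{\max}$. 2. Set $\hat d_k=\mathcal P_{\mathcal S}[x_k-\eta_k\nabla f(x_k)]-x_k$ and $\hat s_k=\mathcal P_{\mathcal S}[x_k+s_k]-x_k$. If $\hat d_k=0$, stop and return $x_k$. 3. If $\hat s_k=0$, set $d_k=\hat d_k$. If $\hat s_k\ne0$: (3a) Determine the symmetric matrix $H_k\in\mathbb R^{2\times2}$ by the three interpolation conditions $\varphi_k(\alpha_i,\beta_i;H_k)=f(x_k+\alpha_i\hat d_k+\beta_i\hat s_k)$, $i=1,2,3$, at three points $(\alpha_i,\beta_i)\neq(0,0)$ for which this $3\times3$ linear system in the entries of $H_k$ is uniquely solvable. Let $(\alpha_k,\beta_k)$ be a global minimizer of $\varphi_k(\alpha,\beta;H_k)$ over $\{\alpha\ge0,\ \beta\ge0,\ \alpha+\beta\le1\}$ (computed in closed form) and set $d_k=\alpha_k\hat d_k+\beta_k\hat s_k$. (3b) If it is not the case that both $\nabla f(x_k)^Td_k\le-\bar c_1\|d_k\|^2$ and $\nabla f(x_k)^Td_k\le-\bar c_2\|\mathcal P_{\mathcal S}[x_k-\eta\nabla f(x_k)]-x_k\|^2$ hold, then define the symmetric matrix $\tilde H_k\in\mathbb R^{2\times 2}$ by $(\tilde H_k)_{11}=\max\{\min\{(H_k)_{11},\hat\nu_2\|\hat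 d_k\|^2\},\hat\nu_1\|\hat d_k\|^2\}$, $(\tilde H_k)_{22}=\max\{(H_k)_{22},\hat\nu_1\|\hat s_k\|^2\}$, $(\tilde H_k)_{12}=\max\{\min\{(H_k)_{12},\tilde r_k\},-\tilde r_k\}$, where $\tilde r_k=\sqrt{\big((\tilde H_k)_{11}-\hat\nu_1\|\hat d_k\|^2\big)\big((\tilde H_k)_{22}-\hat\nu_1\|\hat s_k\|^2\big)}$; let $(\alpha_k,\beta_k)$ be a global minimizer of $\varphi_k(\alpha,\beta;\tilde H_k)$ over $\{\alpha\ge0,\ \beta\ge0,\ \alpha+\beta\le1\}$ and redefine $d_k=\alpha_k\hat d_k+\beta_k\hat s_k$. 4. Set $\mu=1$; while $f(x_k+\mu d_k)>f(x_k)+\gamma\mu\nabla f(x_k)^Td_k$, replace $\mu$ by $\delta\mu$. Set $\mu_k=\mu$ and $x_{k+1}=x_k+\mu_kd_k$. The parameter $\eta$ in $\phi_\eta$ is the input parameter $\eta$ of the algorithm. If the algorithm stops at iteration $\bar k$, the sequence consists of $x_0,\dots,x_{\bar k}$. *)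

theory Defs
  imports "HOL-Analysis.Analysis" "HOL-Library.While_Combinator"
begin

definition grad :: "(real ^ 'n \<Rightarrow> real) \<Rightarrow> real ^ 'n \<Rightarrow> real ^ 'n" where
  "grad f x = (THE D. GDERIV f x :> D)"

text \<open>\<open>\<phi>\<^sub>\<eta>(x)\<close>, with \<^const>\<open>closest_point\<close> as the Euclidean projection.\<close>

definition crit_measure ::
    "(real ^ 'n) set \<Rightarrow> (real ^ 'n \<Rightarrow> real) \<Rightarrow> real \<Rightarrow> real ^ 'n \<Rightarrow> real" where
  "crit_measure S f \<eta> x = norm (closest_point S (x - \<eta> *\<^sub>R grad f x) - x)"

definition stationary ::
    "(real ^ 'n) set \<Rightarrow> (real ^ 'n \<Rightarrow> real) \<Rightarrow> real ^ 'n \<Rightarrow> bool" where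
  "stationary S f z \<longleftrightarrow> z \<in> S \<and> (\<forall>x\<in>S. grad f z \<bullet> (x - z) \<ge> 0)"

definition accumulation_point :: "(nat \<Rightarrow> real ^ 'n) \<Rightarrow> real ^ 'n \<Rightarrow> bool" where
  "accumulation_point x z \<longleftrightarrow> (\<exists>r :: nat \<Rightarrow> nat. strict_mono r \<and> (x \<circ> r) \<longlonglongrightarrow> z)"

text \<open>The convention \<open>x\<^sub>-\<^sub>1 = x\<^sub>0\<close> is obtained from \<open>0 - 1 = 0\<close> on \<^typ>\<open>nat\<close>.\<close>

definition pgmm_s :: "(nat \<Rightarrow> real ^ 'n) \<Rightarrow> nat \<Rightarrow> real ^ 'n" where
  "pgmm_s x k = x k - x (k - 1)"

definition pgmm_y :: "(real ^ 'n \<Rightarrow> real) \<Rightarrow> (nat \<Rightarrow> real ^ 'n) \<Rightarrow> nat \<Rightarrow> real ^ 'n" where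
  "pgmm_y f x k = grad f (x k) - grad f (x (k - 1))"

definition pgmm_eta ::
    "(real ^ 'n \<Rightarrow> real) \<Rightarrow> real \<Rightarrow> real \<Rightarrow> (nat \<Rightarrow> real ^ 'n) \<Rightarrow> nat \<Rightarrow> real" where
  "pgmm_eta f \<eta>min \<eta>max x k =
     (let s = pgmm_s x k; y = pgmm_y f x k in
      if s \<bullet> y > 0 then min \<eta>max (max \<eta>min ((s \<bullet> s) / (s \<bullet> y))) else \<eta>max)"

definition pgmm_dhat ::
    "(real ^ 'n) set \<Rightarrow> (real ^ 'n \<Rightarrow> real) \<Rightarrow> real \<Rightarrow> real \<Rightarrow> (nat \<Rightarrow> real ^ 'n) \<Rightarrow> nat \<Rightarrow> real ^ 'n"
  where
  "pgmm_dhat S f \<eta>min \<eta>max x k =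
     closest_point S (x k - pgmm_eta f \<eta>min \<eta>max x k *\<^sub>R grad f (x k)) - x k"

definition pgmm_shat :: "(real ^ 'n) set \<Rightarrow> (nat \<Rightarrow> real ^ 'n) \<Rightarrow> nat \<Rightarrow> real ^ 'n" where
  "pgmm_shat S x k = closest_point S (x k + pgmm_s x k) - x k"

definition quad_model ::
    "(real ^ 'n \<Rightarrow> real) \<Rightarrow> real ^ 'n \<Rightarrow> real ^ 'n \<Rightarrow> real ^ 'n \<Rightarrow> real ^ 2 ^ 2 \<Rightarrow> real \<times> real \<Rightarrow> real"
  where
  "quad_model f x dh sh H = (\<lambda>(\<alpha>, \<beta>).
     f x + \<alpha> * (grad f x \<bullet> dh) + \<beta> * (grad f x \<bullet> sh)
       + 1/2 * ((vector [\<alpha>, \<beta>] :: real ^ 2) \<bullet> (H *v vector [\<alpha>, \<beta>])))"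

definition interpolates ::
    "(real ^ 'n \<Rightarrow> real) \<Rightarrow> real ^ 'n \<Rightarrow> real ^ 'n \<Rightarrow> real ^ 'n \<Rightarrow> (3 \<Rightarrow> real \<times> real)
       \<Rightarrow> real ^ 2 ^ 2 \<Rightarrow> bool" where
  "interpolates f x dh sh p H \<longleftrightarrow>
     transpose H = H \<and>
     (\<forall>i. quad_model f x dh sh H (p i) = f (x + fst (p i) *\<^sub>R dh + snd (p i) *\<^sub>R sh))"

definition simplex_minimizer ::
    "(real ^ 'n \<Rightarrow> real) \<Rightarrow> real ^ 'n \<Rightarrow> real ^ 'n \<Rightarrow> real ^ 'n \<Rightarrow> real ^ 2 ^ 2 \<Rightarrow> real \<times> real \<Rightarrow> bool"
  where
  "simplex_minimizer f x dh sh H =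
     is_arg_min (quad_model f x dh sh H) (\<lambda>(\<alpha>, \<beta>). \<alpha> \<ge> 0 \<and> \<beta> \<ge> 0 \<and> \<alpha> + \<beta> \<le> 1)"

definition safeguarded ::
    "real \<Rightarrow> real \<Rightarrow> real ^ 'n \<Rightarrow> real ^ 'n \<Rightarrow> real ^ 2 ^ 2 \<Rightarrow> real ^ 2 ^ 2" where
  "safeguarded \<nu>1 \<nu>2 dh sh H =
     (let h11 = max (min (H $ 1 $ 1) (\<nu>2 * (norm dh)\<^sup>2)) (\<nu>1 * (norm dh)\<^sup>2);
          h22 = max (H $ 2 $ 2) (\<nu>1 * (norm sh)\<^sup>2);
          r = sqrt ((h11 - \<nu>1 * (norm dh)\<^sup>2) * (h22 - \<nu>1 * (norm sh)\<^sup>2));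
          h12 = max (min (H $ 1 $ 2) r) (- r)
      in vector [vector [h11, h12], vector [h12, h22]])"

definition descent_test ::
    "(real ^ 'n) set \<Rightarrow> (real ^ 'n \<Rightarrow> real) \<Rightarrow> real \<Rightarrow> real \<Rightarrow> real \<Rightarrow> real ^ 'n \<Rightarrow> real ^ 'n \<Rightarrow> bool"
  where
  "descent_test S f \<eta> c1 c2 x d \<longleftrightarrow>
     grad f x \<bullet> d \<le> - c1 * (norm d)\<^sup>2 \<and>
     grad f x \<bullet> d \<le> - c2 * (norm (closest_point S (x - \<eta> *\<^sub>R grad f x) - x))\<^sup>2"

text \<open>A relation, not a function: the interpolation points and the minimizers are free choices
  of the algorithm. \<open>d\<close> is a possible outcome of step 3 at the point \<open>x\<close>.\<close>

definition pgmm_direction ::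
    "(real ^ 'n) set \<Rightarrow> (real ^ 'n \<Rightarrow> real) \<Rightarrow> real \<Rightarrow> real \<Rightarrow> real \<Rightarrow> real \<Rightarrow> real
       \<Rightarrow> real ^ 'n \<Rightarrow> real ^ 'n \<Rightarrow> real ^ 'n \<Rightarrow> real ^ 'n \<Rightarrow> bool" where
  "pgmm_direction S f \<eta> c1 c2 \<nu>1 \<nu>2 x dh sh d \<longleftrightarrow>
     (if sh = 0 then d = dh
      else \<exists>p H \<alpha> \<beta>.
        (\<forall>i. p i \<noteq> (0, 0)) \<and>
        (\<exists>!H'. interpolates f x dh sh p H') \<and>
        interpolates f x dh sh p H \<and>
        simplex_minimizer f x dh sh H (\<alpha>, \<beta>) \<and>
        (if descent_test S f \<eta> c1 c2 x (\<alpha> *\<^sub>R dh + \<beta> *\<^sub>R sh)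
         then d = \<alpha> *\<^sub>R dh + \<beta> *\<^sub>R sh
         else \<exists>\<alpha>' \<beta>'.
           simplex_minimizer f x dh sh (safeguarded \<nu>1 \<nu>2 dh sh H) (\<alpha>', \<beta>') \<and>
           d = \<alpha>' *\<^sub>R dh + \<beta>' *\<^sub>R sh))"

text \<open>The loop of step 4. The second component counts the evaluations of \<open>f\<close> at trial points
  \<open>x + \<mu> d\<close>, including the one at the accepted point; the result is \<^term>\<open>None\<close> if the loop does not
  terminate.\<close>

definition line_search ::
    "(real ^ 'n \<Rightarrow> real) \<Rightarrow> real \<Rightarrow> real \<Rightarrow> real ^ 'n \<Rightarrow> real ^ 'n \<Rightarrow> (real \<times> nat) option" where
  "line_search f \<gamma> \<delta> x d =
     while_option (\<lambda>(\<mu>, e). f (x + \<mu> *\<^sub>R d) > f x + \<gamma> * \<mu> * (grad f x \<bullet> d))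
                  (\<lambda>(\<mu>, e). (\<delta> * \<mu>, Suc e)) (1, 1)"

text \<open>A maximal run of the algorithm: \<open>x k\<close> and \<open>d k\<close> are the iterates and directions, and \<open>T\<close> is the
  index of the last iteration, with \<open>T = \<infinity>\<close> if there is none. Entries of \<open>x\<close> and \<open>d\<close> beyond \<open>T\<close> are
  irrelevant. Termination of the line search is not presupposed: a run may also end at \<open>T\<close> because
  the line search loops forever there.\<close>

definition pgmm_run ::
    "(real ^ 'n) set \<Rightarrow> (real ^ 'n \<Rightarrow> real) \<Rightarrow> real ^ 'n \<Rightarrow> real \<Rightarrow> real \<Rightarrow> real \<Rightarrow> real \<Rightarrow> real
       \<Rightarrow> real \<Rightarrow> real \<Rightarrow> real \<Rightarrow> real
       \<Rightarrow> (nat \<Rightarrow> real ^ 'n) \<Rightarrow> (nat \<Rightarrow> real ^ 'n) \<Rightarrow> enat \<Rightarrow> bool" where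
  "pgmm_run S f x0 \<gamma> \<delta> \<eta>min \<eta> \<eta>max c1 c2 \<nu>1 \<nu>2 x d T \<longleftrightarrow>
     x 0 = x0 \<and>
     (\<forall>k. enat k \<le> T \<longrightarrow> pgmm_dhat S f \<eta>min \<eta>max x k \<noteq> 0 \<longrightarrow>
        pgmm_direction S f \<eta> c1 c2 \<nu>1 \<nu>2 (x k)
          (pgmm_dhat S f \<eta>min \<eta>max x k) (pgmm_shat S x k) (d k)) \<and>
     (\<forall>k. enat k < T \<longrightarrow> pgmm_dhat S f \<eta>min \<eta>max x k \<noteq> 0 \<and>
        (\<exists>\<mu> e. line_search f \<gamma> \<delta> (x k) (d k) = Some (\<mu>, e) \<and> x (Suc k) = x k + \<mu> *\<^sub>R d k)) \<and>
     (\<forall>k. T = enat k \<longrightarrow>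
        pgmm_dhat S f \<eta>min \<eta>max x k = 0 \<or> line_search f \<gamma> \<delta> (x k) (d k) = None)"

definition k_eps ::
    "(real ^ 'n) set \<Rightarrow> (real ^ 'n \<Rightarrow> real) \<Rightarrow> real \<Rightarrow> (nat \<Rightarrow> real ^ 'n) \<Rightarrow> enat \<Rightarrow> real \<Rightarrow> nat" where
  "k_eps S f \<eta> x T \<epsilon> = (LEAST k. enat k \<le> T \<and> crit_measure S f \<eta> (x k) \<le> \<epsilon>)"

definition unsolved_iterations ::
    "(real ^ 'n) set \<Rightarrow> (real ^ 'n \<Rightarrow> real) \<Rightarrow> real \<Rightarrow> (nat \<Rightarrow> real ^ 'n) \<Rightarrow> enat \<Rightarrow> real \<Rightarrow> nat set"
  where
  "unsolved_iterations S f \<eta> x T \<epsilon> = {k. enat k \<le> T \<and> crit_measure S f \<eta> (x k) > \<epsilon>}"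

text \<open>Operations performed in the iterations \<open>0, \<dots>, K - 1\<close>, meaningful for \<^prop>\<open>enat K \<le> T\<close>: then none
  of these iterations is the last one, so each runs through all steps and its line search terminates.
  No value is reused from an earlier iteration, which only increases the counts.

  Function values per iteration: \<open>f (x k)\<close>; the three interpolation values if \<open>s\<close>-hat is nonzero;
  the trial values of the line search. Gradients: at \<open>x k\<close> and at the previous iterate. Projections:
  those defining \<open>d\<close>-hat and \<open>s\<close>-hat, and, if \<open>s\<close>-hat is nonzero, the one in the descent test.\<close>

definition fun_evals ::
    "(real ^ 'n) set \<Rightarrow> (real ^ 'n \<Rightarrow> real) \<Rightarrow> real \<Rightarrow> real
       \<Rightarrow> (nat \<Rightarrow> real ^ 'n) \<Rightarrow> (nat \<Rightarrow> real ^ 'n) \<Rightarrow> nat \<Rightarrow> nat" where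
  "fun_evals S f \<gamma> \<delta> x d K =
     (\<Sum>k<K. 1 + (if pgmm_shat S x k = 0 then 0 else 3)
               + snd (the (line_search f \<gamma> \<delta> (x k) (d k))))"

definition grad_evals :: "nat \<Rightarrow> nat" where
  "grad_evals K = (\<Sum>k<K. 2)"

definition projections :: "(real ^ 'n) set \<Rightarrow> (nat \<Rightarrow> real ^ 'n) \<Rightarrow> nat \<Rightarrow> nat" where
  "projections S x K = (\<Sum>k<K. 2 + (if pgmm_shat S x k = 0 then 0 else 1))"

end

theory Submission imports Defs begin

text \<open>
  Every direction produced by the algorithm satisfies \<open>\<nabla>f(x)\<^sup>Td \<le> -c \<parallel>d\<parallel>\<^sup>2\<close> and
  \<open>\<nabla>f(x)\<^sup>Td \<le> -c' \<phi>\<^sub>\<eta>(x)\<^sup>2\<close> with constants independent of the iteration. For the safeguarded model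
  this is because its Hessian dominates the diagonal matrix with entries \<open>\<nu>\<^sub>1 \<parallel>dh\<parallel>\<^sup>2\<close> and
  \<open>\<nu>\<^sub>1 \<parallel>sh\<parallel>\<^sup>2\<close> (\<open>dh\<close>, \<open>sh\<close> being the two projected directions), which turns a nonpositive model
  change into the first inequality, while comparison of the minimizer with a fixed step along the
  projected gradient gives the second. By the first inequality and the descent lemma the line
  search stops after boundedly many backtracking steps, so by the second each iteration decreases
  \<open>f\<close> by a multiple of \<open>\<phi>\<^sub>\<eta>(x)\<^sup>2\<close>; since \<open>f\<close> is bounded below, these decreases are summable.
\<close>

section \<open>Gradients and the descent lemma\<close>

text \<open>\<open>grad\<close> is a definite description, so existence and uniqueness must be
  supplied. Existence comes from the values of the derivative on the basis, uniqueness from testing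
  two representing vectors against their own difference.\<close>

lemma GDERIV_grad:
  fixes f :: "real ^ 'n \<Rightarrow> real"
  assumes "f differentiable (at x)"
  shows "GDERIV f x :> grad f x"
proof -
  from assms obtain F where F: "(f has_derivative F) (at x)"
    by (auto simp: differentiable_def)
  then interpret F: bounded_linear F by (rule has_derivative_bounded_linear)
  define D where "D = (\<Sum>b\<in>Basis. F b *\<^sub>R b)"
  have "F h = h \<bullet> D" for h
  proof -
    have "F h = F (\<Sum>b\<in>Basis. (h \<bullet> b) *\<^sub>R b)" by (simp add: euclidean_representation)
    also have "\<dots> = h \<bullet> D"
      by (simp add: F.sum F.scaleR D_def inner_sum_right mult.commute)
    finally show ?thesis .
  qed
  then have "F = (\<lambda>h. h \<bullet> D)" by auto
  with F have D: "GDERIV f x :> D" by (simp add: gderiv_def)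
  have uniq: "D' = D" if "GDERIV f x :> D'" for D'
  proof -
    have "(\<lambda>h. h \<bullet> D') = (\<lambda>h. h \<bullet> D)"
      using that D unfolding gderiv_def by (rule has_derivative_unique)
    then have "(D' - D) \<bullet> D' = (D' - D) \<bullet> D" by meson
    then have "(D' - D) \<bullet> (D' - D) = 0" by (simp add: inner_diff_right)
    then show ?thesis by simp
  qed
  show ?thesis unfolding grad_def using D uniq by (rule theI)
qed

lemma lipschitz_gradient_upper_bound:
  fixes f :: "'a :: real_inner \<Rightarrow> real"
  assumes g: "\<And>z. z \<in> D \<Longrightarrow> GDERIV f z :> g z" and "convex D"
    and lip: "\<And>u v. u \<in> D \<Longrightarrow> v \<in> D \<Longrightarrow> norm (g u - g v) \<le> L * norm (u - v)"
    and u: "u \<in> D" and uv: "u + v \<in> D"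
  shows "f (u + v) \<le> f u + g u \<bullet> v + L / 2 * (norm v)\<^sup>2"
proof -
  \<comment> \<open>Up to the constant \<open>f u\<close>, \<open>h\<close> is the excess of
    \<open>f\<close> over its quadratic bound along the segment. Cauchy-Schwarz and the Lipschitz
    condition make its derivative nonpositive.\<close>
  define h where "h t = f (u + t *\<^sub>R v) - t * (g u \<bullet> v) - L / 2 * t\<^sup>2 * (norm v)\<^sup>2" for t
  define h' where "h' t = g (u + t *\<^sub>R v) \<bullet> v - g u \<bullet> v - L * t * (norm v)\<^sup>2" for t
  have "h 1 \<le> h 0"
  proof (rule DERIV_nonpos_imp_nonincreasing[where f = h])
    fix t :: real assume t: "0 \<le> t" "t \<le> 1"
    have in_D: "u + t *\<^sub>R v \<in> D"
    proof -
      have "(1 - t) *\<^sub>R u + t *\<^sub>R (u + v) \<in> D"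
        using \<open>convex D\<close> u uv t by (intro convexD) auto
      then show ?thesis by (simp add: algebra_simps)
    qed
    have "((\<lambda>t. f (u + t *\<^sub>R v)) has_derivative (\<lambda>s. (s *\<^sub>R v) \<bullet> g (u + t *\<^sub>R v))) (at t)"
      by (rule has_derivative_compose[where g = f and f = "\<lambda>t. u + t *\<^sub>R v"])
         (use g[OF in_D] in \<open>auto simp: gderiv_def intro!: derivative_eq_intros\<close>)
    then have "((\<lambda>t. f (u + t *\<^sub>R v)) has_field_derivative g (u + t *\<^sub>R v) \<bullet> v) (at t)"
      by (simp add: has_field_derivative_def inner_commute mult_commute_abs)
    then have "(h has_field_derivative h' t) (at t)"
      unfolding h_def h'_def by (auto intro!: derivative_eq_intros)
    moreover have "h' t \<le> 0"
    proof -
      have "(g (u + t *\<^sub>R v) - g u) \<bullet> v \<le> norm (g (u + t *\<^sub>R v) - g u) * norm v"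
        by (rule norm_cauchy_schwarz)
      also have "\<dots> \<le> L * norm (u + t *\<^sub>R v - u) * norm v"
        by (intro mult_right_mono lip in_D u) auto
      also have "\<dots> = L * t * (norm v)\<^sup>2" using t by (simp add: power2_eq_square)
      finally show ?thesis by (simp add: h'_def inner_diff_left)
    qed
    ultimately show "\<exists>y. (h has_field_derivative y) (at t) \<and> y \<le> 0" by blast
  qed simp
  then show ?thesis by (simp add: h_def)
qed

section \<open>Projected gradient steps\<close>

text \<open>This is the variational inequality of the projection, tested at the base point
  \<open>x\<close>, which itself lies in \<open>S\<close>.\<close>

lemma closest_point_step_inner:
  fixes S :: "'a :: euclidean_space set"
  assumes "convex S" "closed S" "x \<in> S" "0 < a"
  shows "g \<bullet> (closest_point S (x - a *\<^sub>R g) - x) \<le> - (norm (closest_point S (x - a *\<^sub>R g) - x))\<^sup>2 / a"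
proof -
  define p where "p = closest_point S (x - a *\<^sub>R g)"
  have "(x - a *\<^sub>R g - p) \<bullet> (x - p) \<le> 0"
    using closest_point_dot[OF assms(1-3)] unfolding p_def .
  then have "a * (g \<bullet> (p - x)) \<le> - (norm (p - x))\<^sup>2"
    by (simp add: power2_norm_eq_inner inner_diff_left inner_diff_right inner_commute algebra_simps)
  then show ?thesis using \<open>0 < a\<close> unfolding p_def by (simp add: field_simps)
qed

text \<open>This lets the varying step size of the algorithm be exchanged for the fixed
  \<open>\<eta>\<close>. Each projection satisfies its variational inequality at the other projected
  point; a combination of the two eliminates \<open>g\<close> and leaves a quadratic inequality in
  the norms.\<close>

lemma closest_point_step_length_mono:
  fixes S :: "'a :: euclidean_space set"
  assumes S: "convex S" "closed S" "x \<in> S" and a: "0 < a" and b: "0 < b"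
  shows "norm (closest_point S (x - b *\<^sub>R g) - x)
           \<le> max 1 (b / a) * norm (closest_point S (x - a *\<^sub>R g) - x)"
proof -
  define u where "u = closest_point S (x - a *\<^sub>R g) - x"
  define v where "v = closest_point S (x - b *\<^sub>R g) - x"
  have uv_in: "x + u \<in> S" "x + v \<in> S"
    using S by (auto simp: u_def v_def intro!: closest_point_in_set)
  have 1: "(- a *\<^sub>R g - u) \<bullet> (v - u) \<le> 0"
    using closest_point_dot[OF S(1,2) uv_in(2), of "x - a *\<^sub>R g"]
    by (simp add: u_def algebra_simps)
  have 2: "(- b *\<^sub>R g - v) \<bullet> (u - v) \<le> 0"
    using closest_point_dot[OF S(1,2) uv_in(1), of "x - b *\<^sub>R g"]
    by (simp add: v_def algebra_simps)
  \<comment> \<open>With the weights \<open>b\<close> and \<open>a\<close>, the two terms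
    \<open>a * b * (g \<bullet> (v - u))\<close> occur with opposite signs and cancel.\<close>
  have "b * ((- a *\<^sub>R g - u) \<bullet> (v - u)) + a * ((- b *\<^sub>R g - v) \<bullet> (u - v)) \<le> 0"
    using 1 2 a b by (simp add: add_nonpos_nonpos mult_nonneg_nonpos)
  then have "b * (u \<bullet> u) + a * (v \<bullet> v) \<le> (a + b) * (u \<bullet> v)"
    by (simp add: inner_diff_left inner_diff_right inner_commute algebra_simps)
  also have "\<dots> \<le> (a + b) * (norm u * norm v)"
    using a b norm_cauchy_schwarz by (intro mult_left_mono) auto
  finally have prod: "(norm v - norm u) * (a * norm v - b * norm u) \<le> 0"
    by (simp add: norm_eq_sqrt_inner[symmetric] power2_norm_eq_inner[symmetric] power2_eq_square
        algebra_simps)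
  \<comment> \<open>The factors in \<open>prod\<close> cannot both be positive; the two alternatives
    become the two arguments of \<open>max\<close>.\<close>
  have "norm v \<le> norm u \<or> a * norm v \<le> b * norm u"
  proof (rule ccontr)
    assume "\<not> ?thesis"
    then have "0 < (norm v - norm u) * (a * norm v - b * norm u)" by simp
    with prod show False by simp
  qed
  then have "norm v \<le> 1 * norm u \<or> norm v \<le> b / a * norm u"
    using a by (auto simp: field_simps)
  then show ?thesis
    unfolding u_def v_def
    by (meson max.cobounded1 max.cobounded2 mult_right_mono norm_ge_zero order_trans)
qed

lemma stationary_if_closest_point_step_eq:
  fixes S :: "(real ^ 'n) set"
  assumes S: "convex S" "closed S" "x \<in> S" and "0 < a"
    and eq: "closest_point S (x - a *\<^sub>R grad f x) = x"
  shows "stationary S f x"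
  unfolding stationary_def
proof (intro conjI ballI)
  fix y assume "y \<in> S"
  from closest_point_dot[OF S(1,2) this, of "x - a *\<^sub>R grad f x"]
  have "0 \<le> a * (grad f x \<bullet> (y - x))" by (simp add: eq)
  then show "0 \<le> grad f x \<bullet> (y - x)" using \<open>0 < a\<close> by (simp add: zero_le_mult_iff)
qed (fact S)

section \<open>Step sizes and backtracking\<close>

lemma pgmm_eta_bounds:
  assumes "\<eta>min \<le> \<eta>max"
  shows "\<eta>min \<le> pgmm_eta f \<eta>min \<eta>max x k" "pgmm_eta f \<eta>min \<eta>max x k \<le> \<eta>max"
  using assms by (auto simp: pgmm_eta_def Let_def)

text \<open>\<open>while_option\<close> stops at the least iterate violating its loop condition. The
  \<open>N\<close>-th iterate violates it, so all bounds follow from comparing that least index with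
  \<open>N\<close>.\<close>

lemma line_search_terminates:
  assumes "0 < \<delta>" "\<delta> < 1"
    and armijo: "\<And>\<mu>. 0 < \<mu> \<Longrightarrow> \<mu> \<le> \<delta> ^ N \<Longrightarrow> f (x + \<mu> *\<^sub>R d) \<le> f x + \<gamma> * \<mu> * (grad f x \<bullet> d)"
  obtains \<mu> e where "line_search f \<gamma> \<delta> x d = Some (\<mu>, e)" "\<delta> ^ N \<le> \<mu>" "\<mu> \<le> 1" "e \<le> Suc N"
    "f (x + \<mu> *\<^sub>R d) \<le> f x + \<gamma> * \<mu> * (grad f x \<bullet> d)"
proof -
  let ?b = "\<lambda>(\<mu>, e :: nat). f (x + \<mu> *\<^sub>R d) > f x + \<gamma> * \<mu> * (grad f x \<bullet> d)"
  let ?c = "\<lambda>(\<mu>, e). (\<delta> * \<mu>, Suc e)"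
  let ?s = "(1, 1) :: real \<times> nat"
  \<comment> \<open>The counter starts at 1 because the trial at step 1 is itself evaluated, so
    \<open>n\<close> reductions cost \<open>Suc n\<close> values.\<close>
  have iter: "(?c ^^ n) ?s = (\<delta> ^ n, Suc n)" for n by (induction n) auto
  define n where "n = (LEAST n. \<not> ?b ((?c ^^ n) ?s))"
  have N: "\<not> ?b ((?c ^^ N) ?s)"
    unfolding iter using armijo[of "\<delta> ^ N"] \<open>0 < \<delta>\<close> by (simp add: not_less)
  have n: "\<not> ?b ((?c ^^ n) ?s)" unfolding n_def by (rule LeastI[of "\<lambda>n. \<not> ?b ((?c ^^ n) ?s)", OF N])
  have "n \<le> N" unfolding n_def by (rule Least_le[of "\<lambda>n. \<not> ?b ((?c ^^ n) ?s)", OF N])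
  have "line_search f \<gamma> \<delta> x d = Some ((?c ^^ n) ?s)"
    unfolding line_search_def while_option_def n_def by (rule if_P, rule exI, rule N)
  then have "line_search f \<gamma> \<delta> x d = Some (\<delta> ^ n, Suc n)" by (simp only: iter)
  moreover have "\<delta> ^ N \<le> \<delta> ^ n" using \<open>n \<le> N\<close> assms by (intro power_decreasing) auto
  moreover have "\<delta> ^ n \<le> 1" using assms by (intro power_le_one) auto
  ultimately show thesis
    using that \<open>n \<le> N\<close> n unfolding iter by (simp add: not_less)
qed

section \<open>The quadratic model and its safeguarded Hessian\<close>

lemma quad_model_expand:
  "quad_model f x dh sh H (a, b) = f x + a * (grad f x \<bullet> dh) + b * (grad f x \<bullet> sh)
     + 1/2 * (a\<^sup>2 * H $ 1 $ 1 + a * b * (H $ 1 $ 2 + H $ 2 $ 1) + b\<^sup>2 * H $ 2 $ 2)"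
  by (simp add: quad_model_def inner_vec_def matrix_vector_mult_def sum_2 power2_eq_square
      algebra_simps)

text \<open>The off-diagonal entry is clipped at the geometric mean of the excesses \<open>A\<close>
  and \<open>B\<close> of the diagonal entries over their lower bounds. This is the largest radius
  keeping the excess matrix positive semidefinite.\<close>

lemma safeguarded_entries:
  fixes dh sh :: "real ^ 'n"
  assumes "\<nu>1 \<le> \<nu>2"
  shows "safeguarded \<nu>1 \<nu>2 dh sh H $ 1 $ 1 \<le> \<nu>2 * (norm dh)\<^sup>2"
    and "a \<ge> 0 \<Longrightarrow> b \<ge> 0 \<Longrightarrow>
      \<nu>1 * (a\<^sup>2 * (norm dh)\<^sup>2 + b\<^sup>2 * (norm sh)\<^sup>2)
        \<le> a\<^sup>2 * safeguarded \<nu>1 \<nu>2 dh sh H $ 1 $ 1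
          + a * b * (safeguarded \<nu>1 \<nu>2 dh sh H $ 1 $ 2 + safeguarded \<nu>1 \<nu>2 dh sh H $ 2 $ 1)
          + b\<^sup>2 * safeguarded \<nu>1 \<nu>2 dh sh H $ 2 $ 2"
proof -
  define h11 where "h11 = max (min (H $ 1 $ 1) (\<nu>2 * (norm dh)\<^sup>2)) (\<nu>1 * (norm dh)\<^sup>2)"
  define h22 where "h22 = max (H $ 2 $ 2) (\<nu>1 * (norm sh)\<^sup>2)"
  define A where "A = h11 - \<nu>1 * (norm dh)\<^sup>2"
  define B where "B = h22 - \<nu>1 * (norm sh)\<^sup>2"
  define h12 where "h12 = max (min (H $ 1 $ 2) (sqrt (A * B))) (- sqrt (A * B))"
  have entries: "safeguarded \<nu>1 \<nu>2 dh sh H $ 1 $ 1 = h11" "safeguarded \<nu>1 \<nu>2 dh sh H $ 1 $ 2 = h12"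
    "safeguarded \<nu>1 \<nu>2 dh sh H $ 2 $ 1 = h12" "safeguarded \<nu>1 \<nu>2 dh sh H $ 2 $ 2 = h22"
    by (simp_all add: safeguarded_def Let_def h11_def h22_def h12_def A_def B_def)
  show "safeguarded \<nu>1 \<nu>2 dh sh H $ 1 $ 1 \<le> \<nu>2 * (norm dh)\<^sup>2"
    using mult_right_mono[OF assms, of "(norm dh)\<^sup>2"] by (simp add: entries h11_def)
  assume ab: "a \<ge> 0" "b \<ge> 0"
  have "A \<ge> 0" "B \<ge> 0" by (simp_all add: A_def B_def h11_def h22_def)
  \<comment> \<open>For nonnegative \<open>a\<close> and \<open>b\<close> the cross term is smallest
    when \<open>h12\<close> sits at its lower clipping bound; the square below absorbs that worst
    case into the diagonal.\<close>
  have "h12 \<ge> - (sqrt A * sqrt B)" by (simp add: h12_def real_sqrt_mult)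
  then have "a * b * h12 \<ge> a * b * - (sqrt A * sqrt B)" using ab by (intro mult_left_mono) auto
  moreover have "0 \<le> (a * sqrt A - b * sqrt B)\<^sup>2" by simp
  then have "0 \<le> a\<^sup>2 * A - 2 * (a * b * (sqrt A * sqrt B)) + b\<^sup>2 * B"
    using \<open>A \<ge> 0\<close> \<open>B \<ge> 0\<close> by (simp add: power2_diff power_mult_distrib algebra_simps)
  ultimately have "0 \<le> a\<^sup>2 * A + 2 * (a * b * h12) + b\<^sup>2 * B" by simp
  then show "\<nu>1 * (a\<^sup>2 * (norm dh)\<^sup>2 + b\<^sup>2 * (norm sh)\<^sup>2)
        \<le> a\<^sup>2 * safeguarded \<nu>1 \<nu>2 dh sh H $ 1 $ 1
          + a * b * (safeguarded \<nu>1 \<nu>2 dh sh H $ 1 $ 2 + safeguarded \<nu>1 \<nu>2 dh sh H $ 2 $ 1)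
          + b\<^sup>2 * safeguarded \<nu>1 \<nu>2 dh sh H $ 2 $ 2"
    unfolding entries by (simp add: A_def B_def algebra_simps)
qed

lemma simplex_minimizerD:
  assumes "simplex_minimizer f x dh sh H (a, b)"
  shows "a \<ge> 0" "b \<ge> 0" "a + b \<le> 1"
    and "\<alpha> \<ge> 0 \<Longrightarrow> \<beta> \<ge> 0 \<Longrightarrow> \<alpha> + \<beta> \<le> 1 \<Longrightarrow>
      quad_model f x dh sh H (a, b) \<le> quad_model f x dh sh H (\<alpha>, \<beta>)"
  using assms by (fastforce simp: simplex_minimizer_def is_arg_min_def not_less)+

lemma safeguarded_direction_descent:
  fixes dh sh :: "real ^ 'n"
  assumes \<nu>: "0 < \<nu>1" "\<nu>1 \<le> \<nu>2" and "0 < \<eta>max"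
    and dh: "grad f x \<bullet> dh \<le> - (norm dh)\<^sup>2 / \<eta>max"
    and min: "simplex_minimizer f x dh sh (safeguarded \<nu>1 \<nu>2 dh sh H) (a, b)"
  shows "grad f x \<bullet> (a *\<^sub>R dh + b *\<^sub>R sh) \<le> - (\<nu>1 / 4) * (norm (a *\<^sub>R dh + b *\<^sub>R sh))\<^sup>2"
    and "grad f x \<bullet> (a *\<^sub>R dh + b *\<^sub>R sh) \<le> - (min 1 (1 / (\<eta>max * \<nu>2)) / (2 * \<eta>max)) * (norm dh)\<^sup>2"
proof -
  let ?H = "safeguarded \<nu>1 \<nu>2 dh sh H"
  let ?d = "a *\<^sub>R dh + b *\<^sub>R sh"
  define q where "q = a\<^sup>2 * ?H $ 1 $ 1 + a * b * (?H $ 1 $ 2 + ?H $ 2 $ 1) + b\<^sup>2 * ?H $ 2 $ 2"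
  have q: "\<nu>1 * (a\<^sup>2 * (norm dh)\<^sup>2 + b\<^sup>2 * (norm sh)\<^sup>2) \<le> q"
    unfolding q_def using safeguarded_entries(2)[OF \<nu>(2)] simplex_minimizerD[OF min] by blast
  have model: "quad_model f x dh sh ?H (a, b) = f x + grad f x \<bullet> ?d + q / 2"
    by (simp add: quad_model_expand q_def inner_add_right)
  \<comment> \<open>The factor 2 from bounding the square of a sum, together with the 1/2 in front
    of \<open>q\<close> in the model, produces the constant \<open>\<nu>1 / 4\<close>.\<close>
  have "(norm ?d)\<^sup>2 \<le> (a * norm dh + b * norm sh)\<^sup>2"
    using norm_triangle_ineq[of "a *\<^sub>R dh" "b *\<^sub>R sh"] simplex_minimizerD[OF min]
    by (intro power_mono) auto
  also have "\<dots> \<le> 2 * (a\<^sup>2 * (norm dh)\<^sup>2 + b\<^sup>2 * (norm sh)\<^sup>2)"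
    using zero_le_power2[of "a * norm dh - b * norm sh"]
    by (simp add: power2_sum power2_diff power_mult_distrib)
  finally have "\<nu>1 * (norm ?d)\<^sup>2 \<le> \<nu>1 * (2 * (a\<^sup>2 * (norm dh)\<^sup>2 + b\<^sup>2 * (norm sh)\<^sup>2))"
    using \<nu> by (intro mult_left_mono) auto
  with q have q_d: "\<nu>1 * (norm ?d)\<^sup>2 \<le> 2 * q" by (simp add: algebra_simps)
  have "quad_model f x dh sh ?H (a, b) \<le> quad_model f x dh sh ?H (0, 0)"
    by (rule simplex_minimizerD[OF min]) auto
  then have "grad f x \<bullet> ?d \<le> - (q / 2)"
    by (simp add: model) (simp add: quad_model_expand)
  with q_d show "grad f x \<bullet> ?d \<le> - (\<nu>1 / 4) * (norm ?d)\<^sup>2" by simp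
  \<comment> \<open>This is the minimizer over the reals of the upper bound
    \<open>- t / \<eta>max + t\<^sup>2 * \<nu>2 / 2\<close> for the model change along
    \<open>dh\<close>, per unit of \<open>(norm dh)\<^sup>2\<close>, cut off at 1 to stay in the
    simplex.\<close>
  define t where "t = min 1 (1 / (\<eta>max * \<nu>2))"
  have t: "0 < t" "t \<le> 1" using \<nu> \<open>0 < \<eta>max\<close> by (auto simp: t_def)
  have "t \<le> 1 / (\<eta>max * \<nu>2)" by (simp add: t_def)
  then have t_nu: "t * \<nu>2 \<le> 1 / \<eta>max" using \<nu> \<open>0 < \<eta>max\<close> by (simp add: field_simps)
  have "0 \<le> q" using q_d \<nu> by (smt (verit) mult_nonneg_nonneg zero_le_power2)
  have "quad_model f x dh sh ?H (a, b) \<le> quad_model f x dh sh ?H (t, 0)"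
    using t by (intro simplex_minimizerD[OF min]) auto
  then have "grad f x \<bullet> ?d \<le> t * (grad f x \<bullet> dh) + t\<^sup>2 * ?H $ 1 $ 1 / 2"
    using \<open>0 \<le> q\<close> by (simp add: model) (simp add: quad_model_expand)
  also have "\<dots> \<le> t * (- (norm dh)\<^sup>2 / \<eta>max) + t\<^sup>2 * (\<nu>2 * (norm dh)\<^sup>2) / 2"
    using t dh safeguarded_entries(1)[OF \<nu>(2), of dh sh H]
    by (intro add_mono mult_left_mono divide_right_mono) auto
  also have "\<dots> = t * (norm dh)\<^sup>2 * (t * \<nu>2 / 2 - 1 / \<eta>max)"
    by (simp add: algebra_simps power2_eq_square)
  \<comment> \<open>By the choice of \<open>t\<close> the curvature costs at most half of the linear
    gain.\<close>
  also have "\<dots> \<le> t * (norm dh)\<^sup>2 * (1 / \<eta>max / 2 - 1 / \<eta>max)"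
    using t t_nu by (intro mult_left_mono) auto
  also have "\<dots> = - (t / (2 * \<eta>max)) * (norm dh)\<^sup>2" by (simp add: field_simps)
  finally show "grad f x \<bullet> ?d \<le> - (min 1 (1 / (\<eta>max * \<nu>2)) / (2 * \<eta>max)) * (norm dh)\<^sup>2"
    by (simp add: t_def)
qed

section \<open>Directions produced by step 3\<close>

text \<open>For weights in the simplex, \<open>x + d\<close> is a convex combination of
  \<open>x\<close>, \<open>x + dh\<close> and \<open>x + sh\<close>.\<close>

lemma pgmm_direction_in_set:
  assumes dir: "pgmm_direction S f \<eta> c1 c2 \<nu>1 \<nu>2 x dh sh d"
    and "convex S" "x \<in> S" "x + dh \<in> S" "x + sh \<in> S"
  shows "x + d \<in> S"
proof -
  have comb: "x + (a *\<^sub>R dh + b *\<^sub>R sh) \<in> S" if "simplex_minimizer f x dh sh H (a, b)" for H a b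
  proof -
    note ab = simplex_minimizerD[OF that]
    have "(1 - a - b) *\<^sub>R x + a *\<^sub>R (x + dh) + b *\<^sub>R (x + sh) \<in> convex hull {x, x + dh, x + sh}"
      using ab unfolding convex_hull_3 by fastforce
    moreover have "convex hull {x, x + dh, x + sh} \<subseteq> S"
      using assms by (intro hull_minimal) auto
    ultimately have "(1 - a - b) *\<^sub>R x + a *\<^sub>R (x + dh) + b *\<^sub>R (x + sh) \<in> S" by blast
    then show ?thesis by (simp add: algebra_simps)
  qed
  show ?thesis using dir assms(4) comb unfolding pgmm_direction_def
    by (auto split: if_splits)
qed

text \<open>The constants are minima over the possible outcomes of step 3, so the estimate of each
  branch can be weakened to a common one; \<open>K\<close> converts the length of \<open>dh\<close>
  into the criticality measure.\<close>

lemma pgmm_direction_descent: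
  fixes dh :: "real ^ 'n"
  assumes dir: "pgmm_direction S f \<eta> c1 c2 \<nu>1 \<nu>2 x dh sh d"
    and \<nu>: "0 < \<nu>1" "\<nu>1 \<le> \<nu>2" and "0 < \<eta>max" and c: "0 < c1" "0 < c2"
    and dh: "grad f x \<bullet> dh \<le> - (norm dh)\<^sup>2 / \<eta>max"
    and crit: "crit_measure S f \<eta> x \<le> K * norm dh" and "0 < K"
    and cA: "cA = min (1 / \<eta>max) (min c1 (\<nu>1 / 4))"
    and cB: "cB = min c2 (min 1 (1 / (\<eta>max * \<nu>2)) / (2 * \<eta>max) / K\<^sup>2)"
  shows "grad f x \<bullet> d \<le> - cA * (norm d)\<^sup>2" and "grad f x \<bullet> d \<le> - cB * (crit_measure S f \<eta> x)\<^sup>2"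
proof -
  let ?crit = "crit_measure S f \<eta> x"
  define \<tau> where "\<tau> = min 1 (1 / (\<eta>max * \<nu>2)) / (2 * \<eta>max)"
  \<comment> \<open>\<open>\<tau>\<close> is the coefficient of the safeguarded branch. Being at
    most \<open>1 / \<eta>max\<close>, it also serves the branch \<open>d = dh\<close>.\<close>
  have \<tau>: "0 < \<tau>" "\<tau> \<le> 1 / \<eta>max" using \<nu> \<open>0 < \<eta>max\<close> by (auto simp: \<tau>_def field_simps min_def)
  have cA_le: "- c' * (norm d)\<^sup>2 \<le> - cA * (norm d)\<^sup>2" if "c' \<in> {1 / \<eta>max, c1, \<nu>1 / 4}" for c'
    using that unfolding cA by (intro mult_right_mono) auto
  have via_crit: "- c2 * ?crit\<^sup>2 \<le> - cB * ?crit\<^sup>2"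
    unfolding cB by (intro mult_right_mono) auto
  have via_dh: "- \<tau> * (norm dh)\<^sup>2 \<le> - cB * ?crit\<^sup>2"
  proof -
    have "?crit\<^sup>2 \<le> (K * norm dh)\<^sup>2"
      using crit by (intro power_mono) (auto simp: crit_measure_def)
    then have "\<tau> / K\<^sup>2 * ?crit\<^sup>2 \<le> \<tau> / K\<^sup>2 * (K * norm dh)\<^sup>2"
      using \<tau> by (intro mult_left_mono) auto
    moreover have "\<tau> / K\<^sup>2 * (K * norm dh)\<^sup>2 = \<tau> * (norm dh)\<^sup>2"
      using \<open>0 < K\<close> by (simp add: power_mult_distrib)
    moreover have "cB * ?crit\<^sup>2 \<le> \<tau> / K\<^sup>2 * ?crit\<^sup>2"
      unfolding cB \<tau>_def by (intro mult_right_mono) auto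
    ultimately show ?thesis by simp
  qed
  \<comment> \<open>An accepted minimizer of the unsafeguarded model is remembered only through the
    test it passed, which states both inequalities directly.\<close>
  consider "d = dh"
    | "descent_test S f \<eta> c1 c2 x d"
    | a b H where "simplex_minimizer f x dh sh (safeguarded \<nu>1 \<nu>2 dh sh H) (a, b)"
        "d = a *\<^sub>R dh + b *\<^sub>R sh"
    using dir unfolding pgmm_direction_def by (auto split: if_splits)
  then have "grad f x \<bullet> d \<le> - cA * (norm d)\<^sup>2 \<and> grad f x \<bullet> d \<le> - cB * ?crit\<^sup>2"
  proof cases
    case 1
    have "\<tau> * (norm dh)\<^sup>2 \<le> 1 / \<eta>max * (norm dh)\<^sup>2" using \<tau> by (intro mult_right_mono) auto
    then show ?thesis using 1 dh cA_le[of "1 / \<eta>max"] via_dh by simp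
  next
    case 2
    then show ?thesis using cA_le[of c1] via_crit
      unfolding descent_test_def crit_measure_def by simp
  next
    case 3
    note desc = safeguarded_direction_descent[OF \<nu> \<open>0 < \<eta>max\<close> dh 3(1), folded 3(2)]
    then show ?thesis using cA_le[of "\<nu>1 / 4"] via_dh unfolding \<tau>_def by simp
  qed
  then show "grad f x \<bullet> d \<le> - cA * (norm d)\<^sup>2" "grad f x \<bullet> d \<le> - cB * ?crit\<^sup>2" by auto
qed

section \<open>Behavior along a run\<close>

text \<open>This gathers what the complexity and limit arguments use about a run. The last property
  excludes a run that ends in a looping line search.\<close>

lemma pgmm_run_decrease:
  fixes S D :: "(real ^ 'n) set" and f :: "real ^ 'n \<Rightarrow> real"
  assumes S: "convex S" "closed S"
    and diff: "\<And>z. f differentiable (at z)"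
    and "L > 0" and "convex D" and "S \<subseteq> D"
    and lipschitz: "\<And>u v. u \<in> D \<Longrightarrow> v \<in> D \<Longrightarrow> norm (grad f u - grad f v) \<le> L * norm (u - v)"
    and "x0 \<in> S"
    and \<gamma>: "0 < \<gamma>" "\<gamma> < 1" and \<delta>: "0 < \<delta>" "\<delta> < 1"
    and \<eta>: "0 < \<eta>min" "\<eta>min \<le> \<eta>" "\<eta> \<le> \<eta>max"
    and c: "c1 > 0" "c2 > 0" and \<nu>: "0 < \<nu>1" "\<nu>1 \<le> \<nu>2"
    and run: "pgmm_run S f x0 \<gamma> \<delta> \<eta>min \<eta> \<eta>max c1 c2 \<nu>1 \<nu>2 x d T"
  obtains c N where "c > 0"
    and "\<And>k. enat k \<le> T \<Longrightarrow> x k \<in> S"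
    and "\<And>k. enat k < T \<Longrightarrow> f (x (Suc k)) \<le> f (x k) - c * (crit_measure S f \<eta> (x k))\<^sup>2"
    and "\<And>k. enat k < T \<Longrightarrow> snd (the (line_search f \<gamma> \<delta> (x k) (d k))) \<le> Suc N"
    and "\<And>k. T = enat k \<Longrightarrow>
      pgmm_dhat S f \<eta>min \<eta>max x k = 0 \<and> stationary S f (x k) \<and> crit_measure S f \<eta> (x k) = 0"
proof -
  let ?crit = "\<lambda>k. crit_measure S f \<eta> (x k)"
  let ?dh = "pgmm_dhat S f \<eta>min \<eta>max x"
  let ?sh = "pgmm_shat S x"
  have "0 < \<eta>" "0 < \<eta>max" using \<eta> by auto
  have \<eta>k: "\<eta>min \<le> pgmm_eta f \<eta>min \<eta>max x k" "pgmm_eta f \<eta>min \<eta>max x k \<le> \<eta>max" for k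
    using pgmm_eta_bounds[of \<eta>min \<eta>max] \<eta> by auto
  \<comment> \<open>This ratio is at least 1 and bounds \<open>\<eta>\<close> divided by any step
    size of the algorithm, so one \<open>K\<close> works for all iterations.\<close>
  define K where "K = \<eta>max / \<eta>min"
  have "0 < K" using \<eta> by (simp add: K_def)
  have crit: "?crit k \<le> K * norm (?dh k)" if "x k \<in> S" for k
  proof -
    let ?a = "pgmm_eta f \<eta>min \<eta>max x k"
    have "0 < ?a" using \<eta>k[of k] \<eta> by simp
    have "?crit k \<le> max 1 (\<eta> / ?a) * norm (?dh k)"
      unfolding crit_measure_def pgmm_dhat_def
      by (rule closest_point_step_length_mono[OF S that \<open>0 < ?a\<close> \<open>0 < \<eta>\<close>])
    also have "\<dots> \<le> K * norm (?dh k)"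
    proof (rule mult_right_mono)
      have "\<eta> / ?a \<le> K" unfolding K_def using \<eta> \<eta>k[of k] by (intro frac_le) auto
      moreover have "1 \<le> K" using \<eta> by (simp add: K_def)
      ultimately show "max 1 (\<eta> / ?a) \<le> K" by simp
    qed simp
    finally show ?thesis .
  qed
  have dh: "grad f (x k) \<bullet> ?dh k \<le> - (norm (?dh k))\<^sup>2 / \<eta>max" if "x k \<in> S" for k
  proof -
    let ?a = "pgmm_eta f \<eta>min \<eta>max x k"
    have "0 < ?a" using \<eta>k[of k] \<eta> by simp
    have "grad f (x k) \<bullet> ?dh k \<le> - (norm (?dh k))\<^sup>2 / ?a"
      unfolding pgmm_dhat_def by (rule closest_point_step_inner[OF S that \<open>0 < ?a\<close>])
    moreover have "(norm (?dh k))\<^sup>2 / \<eta>max \<le> (norm (?dh k))\<^sup>2 / ?a"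
      using \<eta>k[of k] \<open>0 < ?a\<close> by (intro divide_left_mono) auto
    ultimately show ?thesis by simp
  qed
  define cA where "cA = min (1 / \<eta>max) (min c1 (\<nu>1 / 4))"
  define cB where "cB = min c2 (min 1 (1 / (\<eta>max * \<nu>2)) / (2 * \<eta>max) / K\<^sup>2)"
  have pos: "0 < cA" "0 < cB"
    using \<open>0 < \<eta>max\<close> c \<nu> \<open>0 < K\<close> by (auto simp: cA_def cB_def)
  have "0 < 2 * (1 - \<gamma>) * cA / L" using pos \<gamma> \<open>L > 0\<close> by simp
  \<comment> \<open>By the descent lemma and the first descent inequality, the Armijo condition
    holds for every step up to this threshold, as long as the step is at most 1.\<close>
  then obtain N where N: "\<delta> ^ N < 2 * (1 - \<gamma>) * cA / L"
    using real_arch_pow_inv \<delta> by blast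
  \<comment> \<open>Armijo decrease with an accepted step of at least \<open>\<delta> ^ N\<close>
    and slope at most \<open>- cB\<close> times the squared criticality measure.\<close>
  define c where "c = \<gamma> * \<delta> ^ N * cB"
  have "0 < c" using pos \<gamma> \<delta> by (simp add: c_def)
  \<comment> \<open>Membership of \<open>x k\<close> in \<open>S\<close> is a premise here because
    \<open>in_S\<close> is later proved by induction from this very fact.\<close>
  have step: "\<exists>\<mu> e. line_search f \<gamma> \<delta> (x k) (d k) = Some (\<mu>, e) \<and> e \<le> Suc N \<and>
      x k + \<mu> *\<^sub>R d k \<in> S \<and> f (x k + \<mu> *\<^sub>R d k) \<le> f (x k) - c * (?crit k)\<^sup>2"
    if k: "enat k \<le> T" and dh0: "?dh k \<noteq> 0" and xk: "x k \<in> S" for k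
  proof -
    have dir: "pgmm_direction S f \<eta> c1 c2 \<nu>1 \<nu>2 (x k) (?dh k) (?sh k) (d k)"
      using run k dh0 unfolding pgmm_run_def by blast
    let ?gd = "grad f (x k) \<bullet> d k"
    have gd: "?gd \<le> - cA * (norm (d k))\<^sup>2" "?gd \<le> - cB * (?crit k)\<^sup>2"
      by (rule pgmm_direction_descent[OF dir \<nu> \<open>0 < \<eta>max\<close> \<open>c1 > 0\<close> \<open>c2 > 0\<close> dh[OF xk] crit[OF xk]
            \<open>0 < K\<close> cA_def cB_def])+
    have "x k + d k \<in> S"
      using S xk by (intro pgmm_direction_in_set[OF dir])
        (auto simp: pgmm_dhat_def pgmm_shat_def intro!: closest_point_in_set)
    have in_S: "x k + \<mu> *\<^sub>R d k \<in> S" if "0 \<le> \<mu>" "\<mu> \<le> 1" for \<mu>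
    proof -
      have "(1 - \<mu>) *\<^sub>R x k + \<mu> *\<^sub>R (x k + d k) \<in> S"
        using S xk \<open>x k + d k \<in> S\<close> that by (intro convexD) auto
      then show ?thesis by (simp add: algebra_simps)
    qed
    obtain \<mu> e where ls: "line_search f \<gamma> \<delta> (x k) (d k) = Some (\<mu>, e)" "\<delta> ^ N \<le> \<mu>" "\<mu> \<le> 1"
      "e \<le> Suc N" "f (x k + \<mu> *\<^sub>R d k) \<le> f (x k) + \<gamma> * \<mu> * ?gd"
    proof (rule line_search_terminates[OF \<delta>])
      fix \<mu> :: real assume \<mu>: "0 < \<mu>" "\<mu> \<le> \<delta> ^ N"
      \<comment> \<open>This keeps the trial point in \<open>S\<close>, hence in \<open>D\<close>,
        where the gradient is Lipschitz.\<close>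
      have "\<mu> \<le> 1" using \<mu>(2) power_le_one[of \<delta> N] \<delta> by linarith
      have "L * \<mu> \<le> 2 * (1 - \<gamma>) * cA"
        using N \<mu> \<open>L > 0\<close> by (simp add: field_simps) (smt (verit) mult_left_mono)
      then have "L * \<mu> * (norm (d k))\<^sup>2 \<le> 2 * (1 - \<gamma>) * (cA * (norm (d k))\<^sup>2)"
        unfolding mult.assoc[symmetric] by (rule mult_right_mono) simp
      also have "\<dots> \<le> 2 * (1 - \<gamma>) * (- ?gd)" using gd(1) \<gamma> by (intro mult_left_mono) auto
      finally have "\<mu> * (L / 2 * \<mu> * (norm (d k))\<^sup>2) \<le> \<mu> * ((1 - \<gamma>) * (- ?gd))"
        using \<mu> by (intro mult_left_mono) (auto simp: algebra_simps)
      moreover have "f (x k + \<mu> *\<^sub>R d k)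
          \<le> f (x k) + grad f (x k) \<bullet> (\<mu> *\<^sub>R d k) + L / 2 * (norm (\<mu> *\<^sub>R d k))\<^sup>2"
        using in_S[of \<mu>] \<mu> \<open>\<mu> \<le> 1\<close> xk \<open>S \<subseteq> D\<close>
        by (intro lipschitz_gradient_upper_bound[OF GDERIV_grad[OF diff] \<open>convex D\<close> lipschitz]) auto
      ultimately show "f (x k + \<mu> *\<^sub>R d k) \<le> f (x k) + \<gamma> * \<mu> * ?gd"
        by (simp add: power_mult_distrib power2_eq_square algebra_simps)
    qed
    have "0 \<le> \<mu>" using ls(2) \<delta> by (meson less_le order_trans zero_less_power)
    have "c * (?crit k)\<^sup>2 \<le> \<gamma> * \<mu> * (- ?gd)"
    proof -
      have "c * (?crit k)\<^sup>2 = \<gamma> * \<delta> ^ N * (cB * (?crit k)\<^sup>2)" by (simp add: c_def)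
      also have "\<dots> \<le> \<gamma> * \<mu> * (- ?gd)"
        using ls(2) gd(2) \<gamma> \<delta> pos \<open>0 \<le> \<mu>\<close> by (intro mult_mono) auto
      finally show ?thesis .
    qed
    with ls in_S[of \<mu>] \<open>0 \<le> \<mu>\<close> show ?thesis by force
  qed
  have next_iter: "?dh k \<noteq> 0"
    "\<exists>\<mu> e. line_search f \<gamma> \<delta> (x k) (d k) = Some (\<mu>, e) \<and> x (Suc k) = x k + \<mu> *\<^sub>R d k"
    if "enat k < T" for k
    using run that unfolding pgmm_run_def by blast+
  have in_S: "x k \<in> S" if "enat k \<le> T" for k
    using that
  proof (induction k)
    case 0
    then show ?case using run \<open>x0 \<in> S\<close> by (simp add: pgmm_run_def)
  next
    case (Suc k)
    then have "enat k < T" by (simp add: Suc_ile_eq)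
    then show ?case using step[of k] next_iter[of k] Suc.IH by force
  qed
  show thesis
  proof (rule that[OF \<open>0 < c\<close> in_S])
    fix k assume k: "enat k < T"
    then have "x k \<in> S" using in_S by simp
    with k step[of k] next_iter[of k]
    show "f (x (Suc k)) \<le> f (x k) - c * (?crit k)\<^sup>2"
      and "snd (the (line_search f \<gamma> \<delta> (x k) (d k))) \<le> Suc N" by force+
  next
    fix k assume k: "T = enat k"
    then have xk: "x k \<in> S" using in_S by simp
    have "?dh k = 0 \<or> line_search f \<gamma> \<delta> (x k) (d k) = None"
      using run k unfolding pgmm_run_def by simp
    \<comment> \<open>A nonzero projected gradient step would make the line search succeed, so only
      the regular stop remains.\<close>
    with step[of k] k xk have dh0: "?dh k = 0" by (cases "?dh k = 0") auto
    moreover have "0 < pgmm_eta f \<eta>min \<eta>max x k" using \<eta>k[of k] \<eta> by simp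
    moreover have "?crit k = 0" using crit[OF xk] dh0 by (simp add: crit_measure_def)
    ultimately show "?dh k = 0 \<and> stationary S f (x k) \<and> ?crit k = 0"
      using stationary_if_closest_point_step_eq[OF S xk] by (simp add: pgmm_dhat_def)
  qed
qed

section \<open>Complexity bounds and stationarity of accumulation points\<close>

theorem proposition5p1:
  fixes S D :: "(real ^ 'n) set" and f :: "real ^ 'n \<Rightarrow> real"
    and fstar L :: real
    and x0 :: "real ^ 'n" and \<gamma> \<delta> \<eta>min \<eta> \<eta>max c1 c2 \<nu>1 \<nu>2 :: real
    and x d :: "nat \<Rightarrow> real ^ 'n" and T :: enat
  assumes "S \<noteq> {}" and "closed S" and "convex S"
    and smooth: "\<And>z. f differentiable (at z)" "continuous_on UNIV (grad f)"
    and lower_bound: "\<And>z. z \<in> S \<Longrightarrow> f z \<ge> fstar"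
    and "L > 0" and "open D" and "convex D" and "S \<subseteq> D"
    and lipschitz: "\<And>u v. u \<in> D \<Longrightarrow> v \<in> D \<Longrightarrow> norm (grad f u - grad f v) \<le> L * norm (u - v)"
    and "x0 \<in> S"
    and "0 < \<gamma>" "\<gamma> < 1" and "0 < \<delta>" "\<delta> < 1"
    and "0 < \<eta>min" "\<eta>min \<le> \<eta>" "\<eta> \<le> \<eta>max"
    and "c1 > 0" "c2 > 0" and "0 < \<nu>1" "\<nu>1 \<le> \<nu>2"
    and run: "pgmm_run S f x0 \<gamma> \<delta> \<eta>min \<eta> \<eta>max c1 c2 \<nu>1 \<nu>2 x d T"
    and "\<eta>max < 2 / \<nu>1"
  shows "(\<exists>C. \<forall>\<epsilon>>0.
            (\<exists>k. enat k \<le> T \<and> crit_measure S f \<eta> (x k) \<le> \<epsilon>) \<and>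
            real (k_eps S f \<eta> x T \<epsilon>) \<le> C / \<epsilon>\<^sup>2 \<and>
            finite (unsolved_iterations S f \<eta> x T \<epsilon>) \<and>
            real (card (unsolved_iterations S f \<eta> x T \<epsilon>)) \<le> C / \<epsilon>\<^sup>2 \<and>
            real (fun_evals S f \<gamma> \<delta> x d (k_eps S f \<eta> x T \<epsilon>)) \<le> C / \<epsilon>\<^sup>2 \<and>
            real (grad_evals (k_eps S f \<eta> x T \<epsilon>)) \<le> C / \<epsilon>\<^sup>2 \<and>
            real (projections S x (k_eps S f \<eta> x T \<epsilon>)) \<le> C / \<epsilon>\<^sup>2)
       \<and> (compact S \<longrightarrow>
            (\<exists>kbar. T = enat kbar \<and> pgmm_dhat S f \<eta>min \<eta>max x kbar = 0 \<and>
                    stationary S f (x kbar))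
          \<or> (T = \<infinity> \<and> (\<exists>z. accumulation_point x z) \<and>
             (\<forall>z. accumulation_point x z \<longrightarrow> stationary S f z)))"
proof -
  let ?crit = "\<lambda>k. crit_measure S f \<eta> (x k)"
  let ?kE = "k_eps S f \<eta> x T"
  let ?U = "unsolved_iterations S f \<eta> x T"
  obtain c N where "c > 0"
    and in_S: "\<And>k. enat k \<le> T \<Longrightarrow> x k \<in> S"
    and dec: "\<And>k. enat k < T \<Longrightarrow> f (x (Suc k)) \<le> f (x k) - c * (?crit k)\<^sup>2"
    and evals: "\<And>k. enat k < T \<Longrightarrow> snd (the (line_search f \<gamma> \<delta> (x k) (d k))) \<le> Suc N"
    and last: "\<And>k. T = enat k \<Longrightarrow>
      pgmm_dhat S f \<eta>min \<eta>max x k = 0 \<and> stationary S f (x k) \<and> ?crit k = 0"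
    using pgmm_run_decrease[OF \<open>convex S\<close> \<open>closed S\<close> smooth(1) \<open>L > 0\<close> \<open>convex D\<close> \<open>S \<subseteq> D\<close> lipschitz
        \<open>x0 \<in> S\<close> \<open>0 < \<gamma>\<close> \<open>\<gamma> < 1\<close> \<open>0 < \<delta>\<close> \<open>\<delta> < 1\<close> \<open>0 < \<eta>min\<close> \<open>\<eta>min \<le> \<eta>\<close> \<open>\<eta> \<le> \<eta>max\<close>
        \<open>c1 > 0\<close> \<open>c2 > 0\<close> \<open>0 < \<nu>1\<close> \<open>\<nu>1 \<le> \<nu>2\<close> run] by blast
  have "0 < \<eta>" using \<open>0 < \<eta>min\<close> \<open>\<eta>min \<le> \<eta>\<close> by simp
  \<comment> \<open>The total decrease available for \<open>f\<close> on \<open>S\<close>, divided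
    by \<open>c\<close>, bounds all partial sums of squared criticality measures.\<close>
  define M where "M = (f (x 0) - fstar) / c"
  have telescope: "c * (\<Sum>k<n. (?crit k)\<^sup>2) \<le> f (x 0) - f (x n)" if "enat n \<le> T" for n
    using that
  proof (induction n)
    case (Suc n)
    then have "enat n < T" by (simp add: Suc_ile_eq)
    then show ?case using Suc.IH dec[of n] by (simp add: algebra_simps order_less_imp_le)
  qed simp
  have sum_le: "(\<Sum>k<n. (?crit k)\<^sup>2) \<le> M" if "enat n \<le> T" for n
  proof -
    have "c * (\<Sum>k<n. (?crit k)\<^sup>2) \<le> f (x 0) - fstar"
      using telescope[OF that] lower_bound[OF in_S[OF that]] by simp
    then show ?thesis using \<open>c > 0\<close> by (simp add: M_def field_simps)
  qed
  \<comment> \<open>At a last iterate the measure is 0, so every unsolved index has a successor in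
    the run and its decrease is counted in \<open>sum_le\<close>.\<close>
  have unsolved_less: "enat k < T" if "k \<in> ?U \<epsilon>" "\<epsilon> > 0" for k \<epsilon>
    using that last[of k] by (auto simp: unsolved_iterations_def order.order_iff_strict)
  \<comment> \<open>Each index in \<open>A\<close> contributes at least
    \<open>\<epsilon>\<^sup>2\<close> to a sum bounded by \<open>M\<close>. The bound is stated for
    finite subsets because finiteness of \<open>?U \<epsilon>\<close> is itself derived from
    it.\<close>
  have card_le: "real (card A) \<le> M / \<epsilon>\<^sup>2" if "\<epsilon> > 0" "finite A" "A \<subseteq> ?U \<epsilon>" for A \<epsilon>
  proof -
    define n where "n = (if A = {} then 0 else Suc (Max A))"
    have A: "A \<subseteq> {..<n}" using \<open>finite A\<close> by (auto simp: n_def less_Suc_eq_le)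
    have "enat n \<le> T"
    proof (cases "A = {}")
      case False
      then have "Max A \<in> ?U \<epsilon>" using Max_in[OF \<open>finite A\<close>] that by blast
      then show ?thesis using False unsolved_less \<open>\<epsilon> > 0\<close> by (simp add: n_def Suc_ile_eq)
    qed (simp add: n_def flip: zero_enat_def)
    have "real (card A) * \<epsilon>\<^sup>2 = (\<Sum>k\<in>A. \<epsilon>\<^sup>2)" by simp
    also have "\<dots> \<le> (\<Sum>k\<in>A. (?crit k)\<^sup>2)"
      using that by (intro sum_mono power_mono) (auto simp: unsolved_iterations_def)
    also have "\<dots> \<le> (\<Sum>k<n. (?crit k)\<^sup>2)" using A by (intro sum_mono2) auto
    also have "\<dots> \<le> M" by (rule sum_le) fact
    finally show ?thesis using \<open>\<epsilon> > 0\<close> by (simp add: field_simps)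
  qed
  have fin: "finite (?U \<epsilon>)" if "\<epsilon> > 0" for \<epsilon>
  proof (rule ccontr)
    assume "infinite (?U \<epsilon>)"
    then obtain A where "A \<subseteq> ?U \<epsilon>" "finite A" "card A = Suc (nat \<lceil>M / \<epsilon>\<^sup>2\<rceil>)"
      using infinite_arbitrarily_large by blast
    with card_le[OF that, of A] show False by (simp, linarith)
  qed
  have solved: "\<exists>k. enat k \<le> T \<and> ?crit k \<le> \<epsilon>" if "\<epsilon> > 0" for \<epsilon>
  proof (cases T)
    case (enat k)
    then show ?thesis using last[of k] that by (intro exI[of _ k]) simp
  next
    case infinity
    have "?U \<epsilon> \<noteq> UNIV" using fin[OF that] by auto
    then show ?thesis using infinity by (auto simp: unsolved_iterations_def not_less)
  qed
  have kE: "enat (?kE \<epsilon>) \<le> T" "real (?kE \<epsilon>) \<le> M / \<epsilon>\<^sup>2" if "\<epsilon> > 0" for \<epsilon>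
  proof -
    show T: "enat (?kE \<epsilon>) \<le> T"
      using LeastI_ex[OF solved[OF that]] by (simp add: k_eps_def)
    \<comment> \<open>By minimality every index before \<open>?kE \<epsilon>\<close> is unsolved, so
      the count of unsolved indices bounds it too.\<close>
    have "{..<?kE \<epsilon>} \<subseteq> ?U \<epsilon>"
    proof
      fix k assume "k \<in> {..<?kE \<epsilon>}"
      then have k: "k < ?kE \<epsilon>" by simp
      then have "enat k \<le> T" using T by (meson enat_ord_simps(2) less_imp_le order_less_le_trans)
      with not_less_Least[OF k[unfolded k_eps_def]] show "k \<in> ?U \<epsilon>"
        by (auto simp: unsolved_iterations_def)
    qed
    from card_le[OF that _ this] show "real (?kE \<epsilon>) \<le> M / \<epsilon>\<^sup>2" by simp
  qed
  \<comment> \<open>One iteration needs at most 1 + 3 + \<open>Suc N\<close> function values; this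
    coefficient exceeds those of all other counts.\<close>
  define C where "C = (real N + 5) * M"
  have "0 \<le> M" using sum_le[of 0] by (simp flip: zero_enat_def)
  have C: "a * t \<le> C / \<epsilon>\<^sup>2" if "t \<le> M / \<epsilon>\<^sup>2" "0 \<le> a" "a \<le> real N + 5" for a t \<epsilon>
  proof -
    have "a * t \<le> a * (M / \<epsilon>\<^sup>2)" using that by (intro mult_left_mono) auto
    also have "\<dots> \<le> (real N + 5) * (M / \<epsilon>\<^sup>2)" using that \<open>0 \<le> M\<close> by (intro mult_right_mono) auto
    finally show ?thesis by (simp add: C_def)
  qed
  have complexity: "\<forall>\<epsilon>>0.
            (\<exists>k. enat k \<le> T \<and> crit_measure S f \<eta> (x k) \<le> \<epsilon>) \<and>
            real (k_eps S f \<eta> x T \<epsilon>) \<le> C / \<epsilon>\<^sup>2 \<and>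
            finite (unsolved_iterations S f \<eta> x T \<epsilon>) \<and>
            real (card (unsolved_iterations S f \<eta> x T \<epsilon>)) \<le> C / \<epsilon>\<^sup>2 \<and>
            real (fun_evals S f \<gamma> \<delta> x d (k_eps S f \<eta> x T \<epsilon>)) \<le> C / \<epsilon>\<^sup>2 \<and>
            real (grad_evals (k_eps S f \<eta> x T \<epsilon>)) \<le> C / \<epsilon>\<^sup>2 \<and>
            real (projections S x (k_eps S f \<eta> x T \<epsilon>)) \<le> C / \<epsilon>\<^sup>2"
  proof (intro allI impI conjI)
    fix \<epsilon> :: real assume \<epsilon>: "\<epsilon> > 0"
    note K = kE[OF \<epsilon>]
    have less_T: "enat k < T" if "k < ?kE \<epsilon>" for k
      using that K(1) by (meson enat_ord_simps(2) order_less_le_trans)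
    have "fun_evals S f \<gamma> \<delta> x d (?kE \<epsilon>) \<le> (\<Sum>k<?kE \<epsilon>. N + 5)"
      unfolding fun_evals_def using evals[OF less_T] by (intro sum_mono) fastforce
    then have "real (fun_evals S f \<gamma> \<delta> x d (?kE \<epsilon>)) \<le> real (?kE \<epsilon> * (N + 5))"
      by (simp only: of_nat_le_iff) simp
    also have "\<dots> = (real N + 5) * real (?kE \<epsilon>)" by simp
    also have "\<dots> \<le> C / \<epsilon>\<^sup>2" using C[OF K(2)] by simp
    finally show "real (fun_evals S f \<gamma> \<delta> x d (?kE \<epsilon>)) \<le> C / \<epsilon>\<^sup>2" .
    have "projections S x (?kE \<epsilon>) \<le> (\<Sum>k<?kE \<epsilon>. 3)"
      unfolding projections_def by (intro sum_mono) auto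
    then have "real (projections S x (?kE \<epsilon>)) \<le> 3 * real (?kE \<epsilon>)" by simp
    also have "\<dots> \<le> C / \<epsilon>\<^sup>2" using C[OF K(2)] by simp
    finally show "real (projections S x (?kE \<epsilon>)) \<le> C / \<epsilon>\<^sup>2" .
    show "real (grad_evals (?kE \<epsilon>)) \<le> C / \<epsilon>\<^sup>2"
      using C[OF K(2), of 2] by (simp add: grad_evals_def mult.commute)
    show "real (?kE \<epsilon>) \<le> C / \<epsilon>\<^sup>2" using C[OF K(2), of 1] by simp
    show "real (card (?U \<epsilon>)) \<le> C / \<epsilon>\<^sup>2" using C[OF card_le[OF \<epsilon> fin[OF \<epsilon>]], of 1] by simp
  qed (use solved fin in auto)
  have "(T = \<infinity> \<and> (\<exists>z. accumulation_point x z) \<and>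
      (\<forall>z. accumulation_point x z \<longrightarrow> stationary S f z))" if "compact S" "T = \<infinity>"
  proof (intro conjI allI impI)
    have xS: "x k \<in> S" for k using in_S \<open>T = \<infinity>\<close> by simp
    then show "\<exists>z. accumulation_point x z"
      using \<open>compact S\<close> unfolding compact_def accumulation_point_def by blast
    \<comment> \<open>Bounded partial sums of nonnegative terms converge, which drives the measure
      to 0 along the whole sequence.\<close>
    have "summable (\<lambda>k. (?crit k)\<^sup>2)"
      by (rule bounded_imp_summable[where B = M])
         (use sum_le[of "Suc _"] \<open>T = \<infinity>\<close> in \<open>auto simp: lessThan_Suc_atMost\<close>)
    then have "(\<lambda>k. (?crit k)\<^sup>2) \<longlonglongrightarrow> 0" by (rule summable_LIMSEQ_zero)
    then have crit_0: "?crit \<longlonglongrightarrow> 0" by simp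
    fix z assume "accumulation_point x z"
    then obtain r where r: "strict_mono r" "(\<lambda>n. x (r n)) \<longlonglongrightarrow> z"
      by (auto simp: accumulation_point_def comp_def)
    have "z \<in> S" using \<open>closed S\<close> xS r(2) by (rule closed_sequentially)
    \<comment> \<open>Continuity of the gradient and of the projection carries the vanishing measure
      over to the limit \<open>z\<close>.\<close>
    have "continuous_on UNIV (\<lambda>y. closest_point S (y - \<eta> *\<^sub>R grad f y))"
      by (rule continuous_on_compose2[OF
            continuous_on_closest_point[OF \<open>convex S\<close> \<open>closed S\<close> \<open>S \<noteq> {}\<close>, of UNIV]])
         (auto intro!: continuous_intros smooth(2))
    then have "continuous_on UNIV (crit_measure S f \<eta>)"
      unfolding crit_measure_def[abs_def] by (intro continuous_intros)
    then have "(\<lambda>n. ?crit (r n)) \<longlonglongrightarrow> crit_measure S f \<eta> z"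
      using r(2) by (auto intro: continuous_on_tendsto_compose)
    moreover have "(\<lambda>n. ?crit (r n)) \<longlonglongrightarrow> 0"
      using LIMSEQ_subseq_LIMSEQ[OF crit_0 r(1)] by (simp add: comp_def)
    ultimately have "crit_measure S f \<eta> z = 0" by (rule LIMSEQ_unique)
    then show "stationary S f z"
      by (intro stationary_if_closest_point_step_eq[OF \<open>convex S\<close> \<open>closed S\<close> \<open>z \<in> S\<close> \<open>0 < \<eta>\<close>])
         (simp add: crit_measure_def)
  qed fact
  moreover have "\<exists>kbar. T = enat kbar \<and> pgmm_dhat S f \<eta>min \<eta>max x kbar = 0 \<and>
      stationary S f (x kbar)" if "T \<noteq> \<infinity>"
    using that last by (cases T) auto
  ultimately show ?thesis using complexity by blast
qed

end
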